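(* Let $A,B\in\mathcal{M}_{m,n}$. Then: (i) If $\mathrm{R}(B^{*})=\mathrm{N}(A)$, then $A^{*}A+B^{*}B$ is invertible and $A^{\dagger}$ is the unique solution $X$ of the equation $(A^{*}A+B^{*}B)X=A^{*}$. (ii) If $\mathrm{R}(B)=\mathrm{N}(A^{*})$, then $AA^{*}+BB^{*}$ is invertible and $A^{\dagger}$ is the unique solution $X$ of the equation $X(AA^{*}+BB^{*})=A^{*}$. (iii) If $m=n$, $\mathrm{R}(B^{*})=\mathrm{N}(A)$ and $\mathrm{R}(B)\subseteq\mathrm{N}(A^{*})$ (or, $\mathrm{R}(B^{*})\subseteq\mathrm{N}(A)$ and $\mathrm{R}(B)=\mathrm{N}(A^{*})$), then $A+B$ is invertible, $A^{\dagger}=(A+B)^{-1}-B^{\dagger}$, and $A^{\dagger}$ is the unique solution $X$ of any of the equations $(A+B)X=P_{\mathrm{N}(B^{*})}$ and $X(A+B)=P_{\mathrm{N}(B)}$.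
   Context: $\mathbb{F}=\mathbb{R}$ or $\mathbb{F}=\mathbb{C}$; $\mathcal{M}_{m,n}$ is the set of $m\times n$ matrices over $\mathbb{F}$; $A^{*}$ is the conjugate transpose, $\mathrm{N}(A)$ the null space and $\mathrm{R}(A)$ the range (column space) of $A$. $P_{\mathcal{W}}$ denotes the orthogonal projection onto the subspace $\mathcal{W}$. $A^{\dagger}$ is the Moore--Penrose inverse: the unique matrix $X$ with $AXA=A$, $XAX=X$, $(AX)^{*}=AX$, $(XA)^{*}=XA$. *)

theory Defs
  imports "Jordan_Normal_Form.Schur_Decomposition" "Jordan_Normal_Form.Matrix_Kernel"
    "Jordan_Normal_Form.Gauss_Jordan_Elimination" "Jordan_Normal_Form.VS_Connect"
begin

definition mat_range :: "'a::field mat \<Rightarrow> 'a vec set" where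
  "mat_range A = vec_space.col_space (dim_row A) A"

definition is_mp_inverse :: "'a::conjugatable_field mat \<Rightarrow> 'a mat \<Rightarrow> bool" where
  "is_mp_inverse A X \<longleftrightarrow>
     X \<in> carrier_mat (dim_col A) (dim_row A) \<and>
     A * X * A = A \<and> X * A * X = X \<and>
     mat_adjoint (A * X) = A * X \<and> mat_adjoint (X * A) = X * A"

definition mp_inverse :: "'a::conjugatable_field mat \<Rightarrow> 'a mat" where
  "mp_inverse A = (THE X. is_mp_inverse A X)"

(* u \<bullet>c w is the inner product of u with the conjugate of w, so the second condition
   says that v - P v is orthogonal to W. *)
definition orth_proj :: "nat \<Rightarrow> 'a::conjugatable_field vec set \<Rightarrow> 'a mat" where
  "orth_proj n W = (THE P. P \<in> carrier_mat n n \<and>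
     (\<forall>v\<in>carrier_vec n. P *\<^sub>v v \<in> W \<and> (\<forall>w\<in>W. (v - P *\<^sub>v v) \<bullet>c w = 0)))"

end

theory Submission
  imports Defs
begin

text \<open>
  If \<open>A B\<^sup>* = 0\<close>, then \<open>A\<^sup>* A\<close> and \<open>B\<^sup>* B\<close> annihilate each other, so both commute with
  \<open>M = A\<^sup>* A + B\<^sup>* B\<close>; when \<open>M\<close> is invertible, the four Penrose equations for \<open>M\<^sup>-\<^sup>1 A\<^sup>*\<close> follow by
  pure algebra, which gives (i), and (ii) is (i) for the adjoints. In (iii) also
  \<open>A\<^sup>* B = 0\<close>, so \<open>M = (A + B)\<^sup>* (A + B)\<close> and
  \<open>(A + B)\<^sup>-\<^sup>1 = M\<^sup>-\<^sup>1 A\<^sup>* + M\<^sup>-\<^sup>1 B\<^sup>*\<close> is the sum of the two Moore-Penrose inverses.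
\<close>

section \<open>Adjoints\<close>

lemma conjugate_one [simp]: "conjugate (1 :: 'a :: conjugatable_field) = 1"
  by (metis conjugate_dist_mul conjugate_id mult.right_neutral mult.left_neutral)

lemma mat_adjoint_index:
  "i < dim_col A \<Longrightarrow> j < dim_row A \<Longrightarrow> mat_adjoint A $$ (i, j) = conjugate (A $$ (j, i))"
  unfolding mat_adjoint_def by (simp add: mat_of_rows_index)

lemma dim_mat_adjoint [simp]:
  "dim_row (mat_adjoint A) = dim_col A" "dim_col (mat_adjoint A) = dim_row A"
  unfolding mat_adjoint_def by auto

lemma mat_adjoint_carrier [simp]: "A \<in> carrier_mat m n \<Longrightarrow> mat_adjoint A \<in> carrier_mat n m"
  by auto

lemma mat_adjoint_adjoint [simp]: "mat_adjoint (mat_adjoint A) = A"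
  by (rule eq_matI) (auto simp: mat_adjoint_index)

lemma mat_adjoint_zero [simp]: "mat_adjoint (0\<^sub>m m n) = 0\<^sub>m n m"
  by (rule eq_matI) (auto simp: mat_adjoint_index)

lemma mat_adjoint_one [simp]: "mat_adjoint (1\<^sub>m n) = 1\<^sub>m n"
  by (rule eq_matI) (auto simp: mat_adjoint_index)

lemma mat_adjoint_add:
  "dim_row A = dim_row B \<Longrightarrow> dim_col A = dim_col B \<Longrightarrow>
    mat_adjoint (A + B) = mat_adjoint A + mat_adjoint B"
  by (rule eq_matI) (auto simp: mat_adjoint_index conjugate_dist_add)

lemma mat_adjoint_mult:
  "dim_col A = dim_row B \<Longrightarrow> mat_adjoint (A * B) = mat_adjoint B * mat_adjoint A"
  by (rule eq_matI)
    (auto simp: mat_adjoint_index scalar_prod_def sum_conjugate conjugate_dist_mul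
      intro!: sum.cong mult.commute)

text \<open>The characteristic property of the adjoint; it turns statements about ranges and kernels
  into orthogonality.\<close>

lemma mult_mat_vec_cscalar_prod:
  assumes A: "A \<in> carrier_mat m n" and v: "v \<in> carrier_vec n" and w: "w \<in> carrier_vec m"
  shows "(A *\<^sub>v v) \<bullet>c w = v \<bullet>c (mat_adjoint A *\<^sub>v w)"
proof -
  have "(A *\<^sub>v v) \<bullet>c w = (\<Sum>i<m. \<Sum>j<n. A $$ (i, j) * v $ j * conjugate (w $ i))"
    using A v w by (simp add: scalar_prod_def sum_distrib_right atLeast0LessThan)
  also have "\<dots> = (\<Sum>j<n. \<Sum>i<m. A $$ (i, j) * v $ j * conjugate (w $ i))"
    by (rule sum.swap)
  also have "\<dots> = v \<bullet>c (mat_adjoint A *\<^sub>v w)"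
    using A v w
    by (simp add: scalar_prod_def sum_distrib_left sum_conjugate conjugate_dist_mul
        mat_adjoint_index atLeast0LessThan ac_simps)
  finally show ?thesis .
qed

text \<open>By adjointness the inner product of \<open>A v\<close> with itself is that of
  \<open>v\<close> with \<open>A\<^sup>* A v\<close>, hence zero, and the inner product is definite.
  Every passage from a Gram matrix back to its factor rests on this.\<close>

lemma mat_adjoint_mult_eq_0D:
  fixes A :: "'a :: conjugatable_ordered_field mat"
  assumes A: "A \<in> carrier_mat m n" and v: "v \<in> carrier_vec n"
    and 0: "mat_adjoint A *\<^sub>v (A *\<^sub>v v) = 0\<^sub>v n"
  shows "A *\<^sub>v v = 0\<^sub>v m"
proof -
  have w: "A *\<^sub>v v \<in> carrier_vec m" using A v by simp
  have "(A *\<^sub>v v) \<bullet>c (A *\<^sub>v v) = 0"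
    using v by (simp add: mult_mat_vec_cscalar_prod[OF A v w] 0)
  then show ?thesis using w by simp
qed

section \<open>Matrix algebra\<close>

text \<open>The library states these laws with carrier premises whose dimensions occur only there;
  with equations between dimensions as premises they can be used as rewrite rules.\<close>

lemma mult_mat_assoc_dim:
  "dim_col A = dim_row B \<Longrightarrow> dim_col B = dim_row C \<Longrightarrow> A * B * C = A * (B * (C :: 'a :: semiring_0 mat))"
  by (rule assoc_mult_mat) (auto intro: carrier_matI)

lemma add_mult_mat_dim:
  "dim_row A = dim_row B \<Longrightarrow> dim_col A = dim_col B \<Longrightarrow> dim_col B = dim_row C \<Longrightarrow>
    (A + B) * C = A * C + B * (C :: 'a :: semiring_0 mat)"
  by (rule add_mult_distrib_mat) (auto intro: carrier_matI)

lemma mult_add_mat_dim: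
  "dim_row B = dim_row C \<Longrightarrow> dim_col B = dim_col C \<Longrightarrow> dim_col A = dim_row B \<Longrightarrow>
    A * (B + C) = A * B + A * (C :: 'a :: semiring_0 mat)"
  by (rule mult_add_distrib_mat) (auto intro: carrier_matI)

lemma mult_mat_vec_assoc_dim:
  "dim_col A = dim_row B \<Longrightarrow> dim_col B = dim_vec v \<Longrightarrow>
    A * B *\<^sub>v v = A *\<^sub>v (B *\<^sub>v (v :: 'a :: semiring_0 vec))"
  by (rule assoc_mult_mat_vec) (auto intro: carrier_matI carrier_vecI)

lemma add_mult_mat_vec_dim:
  "dim_row A = dim_row B \<Longrightarrow> dim_col A = dim_col B \<Longrightarrow> dim_col B = dim_vec v \<Longrightarrow>
    (A + B) *\<^sub>v v = A *\<^sub>v v + B *\<^sub>v (v :: 'a :: semiring_0 vec)"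
  by (rule add_mult_distrib_mat_vec) (auto intro: carrier_matI carrier_vecI)

lemma add_zero_mat_dim:
  fixes A :: "'a :: monoid_add mat"
  shows "dim_row A = m \<Longrightarrow> dim_col A = n \<Longrightarrow> A + 0\<^sub>m m n = A"
    and "dim_row A = m \<Longrightarrow> dim_col A = n \<Longrightarrow> 0\<^sub>m m n + A = A"
  by (auto intro!: eq_matI)

lemma zero_mat_mult_vec: "v \<in> carrier_vec n \<Longrightarrow> 0\<^sub>m m n *\<^sub>v v = 0\<^sub>v m"
  by (rule eq_vecI) auto

lemma mat_mult_zero_vec: "A \<in> carrier_mat m n \<Longrightarrow> A *\<^sub>v 0\<^sub>v n = 0\<^sub>v m"
  by (rule eq_vecI) auto

lemmas mat_dim_simps = mult_mat_assoc_dim add_mult_mat_dim mult_add_mat_dim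
  mat_adjoint_add mat_adjoint_mult add_zero_mat_dim

text \<open>Simplification nests products to the right, where a known product \<open>A * B\<close>
  is no longer a subterm. This lemma and \<open>mult_mat_left_cong\<close> apply such a fact in
  front of a further factor.\<close>

lemma mult_mat_cancel_0:
  "A * B = 0\<^sub>m k l \<Longrightarrow> dim_col A = dim_row B \<Longrightarrow> dim_col B = dim_row C \<Longrightarrow>
    A * (B * C) = 0\<^sub>m (dim_row A) (dim_col (C :: 'a :: semiring_0 mat))"
  by (metis index_mult_mat(2,3) index_zero_mat(2,3) left_mult_zero_mat' mult_mat_assoc_dim)

lemma mult_mat_left_cong:
  "A * B = C \<Longrightarrow> dim_col A = dim_row B \<Longrightarrow> dim_col B = dim_row D \<Longrightarrow>
    A * (B * D) = C * (D :: 'a :: semiring_0 mat)"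
  by (metis mult_mat_assoc_dim)

lemma mat_eq_0I:
  fixes A :: "'a :: semiring_1 mat"
  assumes A: "A \<in> carrier_mat m n" and 0: "\<And>v. v \<in> carrier_vec n \<Longrightarrow> A *\<^sub>v v = 0\<^sub>v m"
  shows "A = 0\<^sub>m m n"
proof (rule eq_matI)
  fix i j assume "i < dim_row (0\<^sub>m m n :: 'a mat)" "j < dim_col (0\<^sub>m m n :: 'a mat)"
  then have ij: "i < m" "j < n" by auto
  have "A $$ (i, j) = (A *\<^sub>v unit_vec n j) $ i"
    using A ij by simp
  then show "A $$ (i, j) = 0\<^sub>m m n $$ (i, j)"
    using ij 0[of "unit_vec n j"] by simp
qed (use A in auto)

section \<open>Invertible matrices and linear equations with an invertible coefficient\<close>

lemma inverse_mat_ex_if_kernel_trivial: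
  fixes A :: "'a :: field mat"
  assumes A: "A \<in> carrier_mat n n"
    and inj: "\<And>v. v \<in> carrier_vec n \<Longrightarrow> A *\<^sub>v v = 0\<^sub>v n \<Longrightarrow> v = 0\<^sub>v n"
  obtains C where "C \<in> carrier_mat n n" "A * C = 1\<^sub>m n" "C * A = 1\<^sub>m n"
proof -
  have "det A \<noteq> 0"
    using inj det_0_iff_vec_prod_zero_field[OF A] by auto
  \<comment> \<open>\<open>()\<close> is an arbitrary value for the extension field of the record
    \<open>ring_mat\<close>.\<close>
  from det_non_zero_imp_unit[OF A this, of "()"] show thesis
    using that unfolding Units_def ring_mat_def by auto
qed

lemma invertible_matI:
  assumes "A \<in> carrier_mat n n" "C \<in> carrier_mat n n" "A * C = 1\<^sub>m n" "C * A = 1\<^sub>m n"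
  shows "invertible_mat A"
  using assms unfolding invertible_mat_def inverts_mat_def by auto

lemma inverse_mat_unique:
  fixes A :: "'a :: semiring_1 mat"
  assumes "A \<in> carrier_mat n n" "C \<in> carrier_mat n n" "D \<in> carrier_mat n n"
    and "A * C = 1\<^sub>m n" "D * A = 1\<^sub>m n"
  shows "D = C"
proof -
  have "D = D * (A * C)" using assms by simp
  also have "\<dots> = D * A * C" using assms(1-3) by (simp add: mult_mat_assoc_dim)
  also have "\<dots> = C" using assms(2) by (simp only: assms(5) left_mult_one_mat)
  finally show ?thesis .
qed

text \<open>The result \<open>None\<close> would say that \<open>A\<close> is no unit of the matrix
  ring, which \<open>C\<close> refutes; a result \<open>Some D\<close> is a two-sided inverse, so
  uniqueness applies.\<close>

lemma the_mat_inverse_eq: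
  fixes A :: "'a :: field mat"
  assumes A: "A \<in> carrier_mat n n" and C: "C \<in> carrier_mat n n"
    and inv: "A * C = 1\<^sub>m n" "C * A = 1\<^sub>m n"
  shows "the (mat_inverse A) = C"
proof (cases "mat_inverse A")
  case None
  from mat_inverse(1)[OF A None, of "()"] show ?thesis
    using A C inv unfolding Units_def ring_mat_def by auto
next
  case (Some D)
  then show ?thesis
    using mat_inverse(2)[OF A Some] inverse_mat_unique[OF A C] inv by auto
qed

text \<open>Multiplying by \<open>C\<close> recovers every solution from \<open>Z\<close>. The
  carrier condition belongs to the equation: the product is a total function, and
  \<open>M * X = Z\<close> alone does not fix the number of rows of \<open>X\<close>.\<close>

lemma left_equation_iff:
  fixes M :: "'a :: semiring_1 mat"
  assumes M: "M \<in> carrier_mat n n" and C: "C \<in> carrier_mat n n" and inv: "C * M = 1\<^sub>m n"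
    and Y: "Y \<in> carrier_mat n m" and sol: "M * Y = Z"
  shows "X \<in> carrier_mat n m \<and> M * X = Z \<longleftrightarrow> X = Y"
proof -
  have eq: "C * (M * W) = W" if "W \<in> carrier_mat n m" for W
    using M C inv that by (simp add: mult_mat_left_cong)
  show ?thesis using Y sol eq by metis
qed

lemma right_equation_iff:
  fixes M :: "'a :: semiring_1 mat"
  assumes M: "M \<in> carrier_mat n n" and C: "C \<in> carrier_mat n n" and inv: "M * C = 1\<^sub>m n"
    and Y: "Y \<in> carrier_mat m n" and sol: "Y * M = Z"
  shows "X \<in> carrier_mat m n \<and> X * M = Z \<longleftrightarrow> X = Y"
proof -
  have eq: "(W * M) * C = W" if "W \<in> carrier_mat m n" for W
    using M C inv that by (simp add: mat_dim_simps)
  show ?thesis using Y sol eq by metis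
qed

section \<open>Ranges and kernels\<close>

lemma mat_range_eq:
  "A \<in> carrier_mat m n \<Longrightarrow> mat_range A = (\<lambda>v. A *\<^sub>v v) ` carrier_vec n"
  unfolding mat_range_def by (subst vec_space.col_space_eq[of _ _ n]) auto

text \<open>The form in which the inclusions between ranges and null spaces enter the matrix
  algebra.\<close>

lemma mult_eq_0_if_range_subset_kernel:
  fixes A B :: "'a :: field mat"
  assumes A: "A \<in> carrier_mat m n" and B: "B \<in> carrier_mat n k"
    and sub: "mat_range B \<subseteq> mat_kernel A"
  shows "A * B = 0\<^sub>m m k"
proof (rule mat_eq_0I)
  fix v :: "'a vec" assume v: "v \<in> carrier_vec k"
  then have "B *\<^sub>v v \<in> mat_kernel A"
    using sub mat_range_eq[OF B] by auto
  then show "A * B *\<^sub>v v = 0\<^sub>v m"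
    using A B v by (simp add: mat_kernelD)
qed (use A B in simp)

section \<open>Moore-Penrose inverses and orthogonal projections\<close>

text \<open>Penrose's argument: the Hermitian conditions allow \<open>A X\<close> and
  \<open>A Y\<close> to be swapped, which gives \<open>A X = A Y\<close>, and in the same way
  \<open>X A = Y A\<close>. Then \<open>X = X A X = Y A X = Y A Y = Y\<close>.\<close>

lemma is_mp_inverse_unique:
  assumes X: "is_mp_inverse A X" and Y: "is_mp_inverse A Y"
  shows "X = Y"
proof -
  have dims [simp]: "dim_row X = dim_col A" "dim_col X = dim_row A"
      "dim_row Y = dim_col A" "dim_col Y = dim_row A"
    using X Y unfolding is_mp_inverse_def by auto
  note X' = X[unfolded is_mp_inverse_def] and Y' = Y[unfolded is_mp_inverse_def]
  have AXA: "A * X * A = A"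
    and AX_adj: "mat_adjoint (A * X) = A * X" and XA_adj: "mat_adjoint (X * A) = X * A"
    and AY_adj: "mat_adjoint (A * Y) = A * Y" and YA_adj: "mat_adjoint (Y * A) = Y * A"
    using X' Y' by auto
  have "A * X = mat_adjoint (A * Y * A * X)" using X' Y' by simp
  also have "\<dots> = mat_adjoint ((A * Y) * (A * X))" by (simp add: mult_mat_assoc_dim)
  also have "\<dots> = mat_adjoint (A * X) * mat_adjoint (A * Y)" by (rule mat_adjoint_mult) simp
  also have "\<dots> = (A * X * A) * Y" unfolding AX_adj AY_adj by (simp add: mult_mat_assoc_dim)
  also have "\<dots> = A * Y" by (simp only: AXA)
  finally have AX: "A * X = A * Y" .
  have "X * A = mat_adjoint (X * (A * Y * A))" using X' Y' by simp
  also have "\<dots> = mat_adjoint ((X * A) * (Y * A))" by (simp add: mult_mat_assoc_dim)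
  also have "\<dots> = mat_adjoint (Y * A) * mat_adjoint (X * A)" by (rule mat_adjoint_mult) simp
  also have "\<dots> = Y * (A * X * A)" unfolding XA_adj YA_adj by (simp add: mult_mat_assoc_dim)
  also have "\<dots> = Y * A" by (simp only: AXA)
  finally have XA: "X * A = Y * A" .
  have "X = X * A * X" using X' by simp
  also have "\<dots> = Y * (A * X)" unfolding XA by (simp add: mult_mat_assoc_dim)
  also have "\<dots> = Y * A * Y" unfolding AX by (simp add: mult_mat_assoc_dim)
  also have "\<dots> = Y" using Y' by simp
  finally show ?thesis .
qed

lemma mp_inverse_eqI: "is_mp_inverse A X \<Longrightarrow> mp_inverse A = X"
  unfolding mp_inverse_def by (blast intro: is_mp_inverse_unique)

text \<open>Taking adjoints preserves the first two Penrose equations and exchanges the two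
  Hermitian conditions.\<close>

lemma is_mp_inverse_adjoint:
  assumes X: "is_mp_inverse A X"
  shows "is_mp_inverse (mat_adjoint A) (mat_adjoint X)"
proof -
  have [simp]: "dim_row X = dim_col A" "dim_col X = dim_row A"
    using X unfolding is_mp_inverse_def by auto
  note X' = X[unfolded is_mp_inverse_def]
  have "mat_adjoint (A * X * A) = mat_adjoint A" "mat_adjoint (X * A * X) = mat_adjoint X"
    using X' by simp_all
  moreover have "mat_adjoint (A * X) = A * X" "mat_adjoint (X * A) = X * A"
    using X' by simp_all
  ultimately show ?thesis
    unfolding is_mp_inverse_def by (auto simp: mat_dim_simps)
qed

text \<open>With \<open>P = A\<^sup>* A\<close>, the hypothesis gives \<open>A M = A P\<close> and
  \<open>M P = P P = P M\<close>. Hence the inverse \<open>C\<close> of \<open>M\<close> commutes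
  with \<open>P\<close>, and \<open>A P C = A M C = A\<close>.\<close>

lemma mp_inverse_if_orthogonal_rows:
  fixes A B :: "'a :: conjugatable_field mat"
  assumes A: "A \<in> carrier_mat m n" and B: "B \<in> carrier_mat m n"
    and AB: "A * mat_adjoint B = 0\<^sub>m m m"
    and C: "C \<in> carrier_mat n n"
    and MC: "(mat_adjoint A * A + mat_adjoint B * B) * C = 1\<^sub>m n"
    and CM: "C * (mat_adjoint A * A + mat_adjoint B * B) = 1\<^sub>m n"
  shows "is_mp_inverse A (C * mat_adjoint A)"
proof -
  define M where "M = mat_adjoint A * A + mat_adjoint B * B"
  define P where "P = mat_adjoint A * A"
  note dims [simp] = carrier_matD[OF A] carrier_matD[OF B] carrier_matD[OF C]
  have M_dim [simp]: "dim_row M = n" "dim_col M = n" and P_dim [simp]: "dim_row P = n" "dim_col P = n"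
    by (simp_all add: M_def P_def)
  then have M: "M \<in> carrier_mat n n" by (intro carrier_matI)
  have MC: "M * C = 1\<^sub>m n" and CM: "C * M = 1\<^sub>m n" using MC CM by (simp_all add: M_def)
  have "mat_adjoint (A * mat_adjoint B) = 0\<^sub>m m m" using AB by simp
  then have BA: "B * mat_adjoint A = 0\<^sub>m m m" by (simp add: mat_adjoint_mult)
  have P_adj: "mat_adjoint P = P" and M_adj: "mat_adjoint M = M"
    by (simp_all add: P_def M_def mat_dim_simps)
  have "mat_adjoint (C * M) = 1\<^sub>m n" using CM by simp
  then have "M * mat_adjoint C = 1\<^sub>m n" by (simp add: mat_adjoint_mult M_adj)
  \<comment> \<open>Since \<open>M\<close> is Hermitian, \<open>C\<^sup>*\<close> is a right inverse
    of \<open>M\<close>, while \<open>C\<close> is a left inverse.\<close>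
  then have C_adj: "mat_adjoint C = C"
    using inverse_mat_unique[OF M mat_adjoint_carrier[OF C] C _ CM] by simp
  have AM: "A * M = A * P"
    unfolding M_def P_def using A B
    by (simp add: mult_add_mat_dim mult_mat_cancel_0[OF AB] add_zero_mat_dim)
  have APC: "A * (P * C) = A"
    using mult_mat_left_cong[OF AM, of C] A by (simp add: mult_mat_assoc_dim MC)
  then have "mat_adjoint (A * (P * C)) = mat_adjoint A" by simp
  then have CPA: "C * (P * mat_adjoint A) = mat_adjoint A"
    by (simp add: mat_adjoint_mult mult_mat_assoc_dim P_adj C_adj)
  have MP: "M * P = P * P"
  proof -
    have "mat_adjoint B * B * P = 0\<^sub>m n n"
      unfolding P_def by (simp add: mult_mat_assoc_dim mult_mat_cancel_0[OF BA])
    then show ?thesis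
      unfolding M_def P_def[symmetric] by (simp add: add_mult_mat_dim add_zero_mat_dim)
  qed
  have PM: "P * M = P * P"
    using arg_cong[OF MP, of mat_adjoint] by (simp add: mat_adjoint_mult P_adj M_adj)
  have CP: "C * P = P * C"
  proof -
    \<comment> \<open>\<open>M\<close> is inserted next to \<open>P\<close> on the right, moved past
      it, and cancelled on the left.\<close>
    have "C * P = C * (P * M) * C" using MC by (simp add: mult_mat_assoc_dim)
    also have "\<dots> = C * M * (P * C)" unfolding PM MP[symmetric] by (simp add: mult_mat_assoc_dim)
    finally show ?thesis using CM by simp
  qed
  have XA: "C * mat_adjoint A * A = P * C"
    by (simp add: mult_mat_assoc_dim CP flip: P_def)
  have "A * (C * mat_adjoint A) * A = A"
    using XA APC by (simp add: mult_mat_assoc_dim)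
  moreover have "C * mat_adjoint A * A * (C * mat_adjoint A) = C * mat_adjoint A"
  proof -
    have "C * mat_adjoint A * A * (C * mat_adjoint A) = C * (P * C) * mat_adjoint A"
      by (simp add: P_def mult_mat_assoc_dim)
    also have "\<dots> = C * (C * (P * mat_adjoint A))"
      by (simp add: mult_mat_assoc_dim flip: CP)
    finally show ?thesis by (simp add: CPA)
  qed
  moreover have "mat_adjoint (A * (C * mat_adjoint A)) = A * (C * mat_adjoint A)"
    by (simp add: mat_adjoint_mult mult_mat_assoc_dim C_adj)
  moreover have "mat_adjoint (C * mat_adjoint A * A) = C * mat_adjoint A * A"
    unfolding XA by (simp add: mat_adjoint_mult P_adj C_adj CP)
  ultimately show ?thesis
    using A C unfolding is_mp_inverse_def by auto
qed

section \<open>Orthogonal projections onto null spaces\<close>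

text \<open>The equation \<open>P + K\<^sup>* Z = 1\<close> says that \<open>v - P v\<close> lies in the range of \<open>K\<^sup>*\<close>, which is
  orthogonal to the kernel of \<open>K\<close>.\<close>

lemma orth_proj_kernel_eqI:
  fixes K :: "'a :: conjugatable_ordered_field mat"
  assumes K: "K \<in> carrier_mat m n" and P: "P \<in> carrier_mat n n" and Z: "Z \<in> carrier_mat m n"
    and KP: "K * P = 0\<^sub>m m n" and compl: "P + mat_adjoint K * Z = 1\<^sub>m n"
  shows "orth_proj n (mat_kernel K) = P"
proof -
  have mem: "P *\<^sub>v v \<in> mat_kernel K" if v: "v \<in> carrier_vec n" for v
  proof (rule mat_kernelI[OF K])
    have "K *\<^sub>v (P *\<^sub>v v) = K * P *\<^sub>v v" using K P v by simp
    then show "K *\<^sub>v (P *\<^sub>v v) = 0\<^sub>v m" using v by (simp add: KP zero_mat_mult_vec)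
  qed (use P v in auto)
  have orth: "(v - P *\<^sub>v v) \<bullet>c w = 0" if v: "v \<in> carrier_vec n" and w: "w \<in> mat_kernel K" for v w
  proof -
    have wc: "w \<in> carrier_vec n" and Kw: "K *\<^sub>v w = 0\<^sub>v m" using mat_kernelD[OF K w] by auto
    have "v = (P + mat_adjoint K * Z) *\<^sub>v v" using compl v by simp
    also have "\<dots> = P *\<^sub>v v + mat_adjoint K *\<^sub>v (Z *\<^sub>v v)"
      using K P Z v by (simp add: add_mult_mat_vec_dim mult_mat_vec_assoc_dim)
    finally have "v - P *\<^sub>v v = P *\<^sub>v v + mat_adjoint K *\<^sub>v (Z *\<^sub>v v) - P *\<^sub>v v" by simp
    also have "\<dots> = mat_adjoint K *\<^sub>v (Z *\<^sub>v v)"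
      using K P Z v by (intro eq_vecI) auto
    finally have "(v - P *\<^sub>v v) \<bullet>c w = (Z *\<^sub>v v) \<bullet>c (K *\<^sub>v w)"
      using mult_mat_vec_cscalar_prod[of "mat_adjoint K" n m "Z *\<^sub>v v" w] K Z v wc by simp
    then show ?thesis using Z v by (simp add: Kw)
  qed
  show ?thesis unfolding orth_proj_def
  proof (rule the_equality, goal_cases)
    case 1
    then show ?case using P mem orth by auto
  next
    case (2 Q)
    then have Q: "Q \<in> carrier_mat n n"
      and memQ: "\<And>v. v \<in> carrier_vec n \<Longrightarrow> Q *\<^sub>v v \<in> mat_kernel K"
      and orthQ: "\<And>v w. v \<in> carrier_vec n \<Longrightarrow> w \<in> mat_kernel K \<Longrightarrow> (v - Q *\<^sub>v v) \<bullet>c w = 0"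
      by auto
    have "Q - P = 0\<^sub>m n n"
    proof (rule mat_eq_0I)
      fix v :: "'a vec" assume v: "v \<in> carrier_vec n"
      \<comment> \<open>This vector lies in the kernel of \<open>K\<close> and is also a difference
        of two vectors orthogonal to that kernel. So it is orthogonal to itself and
        vanishes.\<close>
      let ?d = "Q *\<^sub>v v - P *\<^sub>v v"
      have Qv: "Q *\<^sub>v v \<in> carrier_vec n" and Pv: "P *\<^sub>v v \<in> carrier_vec n" using P Q v by auto
      have d: "?d \<in> carrier_vec n" using Qv Pv by simp
      have "?d \<in> mat_kernel K"
      proof (rule mat_kernelI[OF K d])
        show "K *\<^sub>v ?d = 0\<^sub>v m"
          using mult_minus_distrib_mat_vec[OF K Qv Pv] mat_kernelD(2)[OF K mem[OF v]]
            mat_kernelD(2)[OF K memQ[OF v]] by simp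
      qed
      then have "(v - P *\<^sub>v v) \<bullet>c ?d - (v - Q *\<^sub>v v) \<bullet>c ?d = 0"
        using orth[OF v] orthQ[OF v] by simp
      also have "(v - P *\<^sub>v v) \<bullet>c ?d - (v - Q *\<^sub>v v) \<bullet>c ?d
          = ((v - P *\<^sub>v v) - (v - Q *\<^sub>v v)) \<bullet>c ?d"
        using v Qv Pv d by (subst minus_scalar_prod_distrib[of _ n]) auto
      also have "(v - P *\<^sub>v v) - (v - Q *\<^sub>v v) = ?d"
        using v P Q by (intro eq_vecI) auto
      finally have "?d = 0\<^sub>v n" using d by simp
      then show "(Q - P) *\<^sub>v v = 0\<^sub>v n"
        using P Q v by (simp add: minus_mult_distrib_mat_vec)
    qed (rule minus_carrier_mat[OF P])
    moreover have "Q = (Q - P) + P" using P Q by (intro eq_matI) auto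
    ultimately show ?case using P by simp
  qed
qed

section \<open>Linear equations for the Moore-Penrose inverse\<close>

text \<open>If the sum kills \<open>v\<close>, applying \<open>A\<close> removes the
  \<open>B\<close> term and leaves \<open>A A\<^sup>* A v = 0\<close>. Cancelling adjoint factors
  gives \<open>A\<^sup>* A v = 0\<close> and then \<open>A v = 0\<close>; what remains of the sum
  gives \<open>B v = 0\<close>.\<close>

lemma gram_sum_inverse_ex:
  fixes A B :: "'a :: conjugatable_ordered_field mat"
  assumes A: "A \<in> carrier_mat m n" and B: "B \<in> carrier_mat m n"
    and AB: "A * mat_adjoint B = 0\<^sub>m m m"
    and inj: "\<And>v. v \<in> carrier_vec n \<Longrightarrow> A *\<^sub>v v = 0\<^sub>v m \<Longrightarrow> B *\<^sub>v v = 0\<^sub>v m \<Longrightarrow> v = 0\<^sub>v n"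
  obtains C where "C \<in> carrier_mat n n"
    "(mat_adjoint A * A + mat_adjoint B * B) * C = 1\<^sub>m n"
    "C * (mat_adjoint A * A + mat_adjoint B * B) = 1\<^sub>m n"
proof (rule inverse_mat_ex_if_kernel_trivial)
  show "mat_adjoint A * A + mat_adjoint B * B \<in> carrier_mat n n" using A B by auto
  fix v :: "'a vec"
  assume v: "v \<in> carrier_vec n" and 0: "(mat_adjoint A * A + mat_adjoint B * B) *\<^sub>v v = 0\<^sub>v n"
  note dims [simp] = carrier_matD[OF A] carrier_matD[OF B] carrier_vecD[OF v]
  have Av: "A *\<^sub>v v \<in> carrier_vec m" and Bv: "B *\<^sub>v v \<in> carrier_vec m" using A B v by auto
  have split: "mat_adjoint A *\<^sub>v (A *\<^sub>v v) + mat_adjoint B *\<^sub>v (B *\<^sub>v v) = 0\<^sub>v n"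
    using 0 A B v by (simp add: add_mult_mat_vec_dim mult_mat_vec_assoc_dim)
  have zero: "A *\<^sub>v (mat_adjoint B *\<^sub>v (B *\<^sub>v v)) = 0\<^sub>v m"
    using Bv mult_mat_vec_assoc_dim[of A "mat_adjoint B" "B *\<^sub>v v"] by (simp add: AB zero_mat_mult_vec)
  have "A *\<^sub>v (mat_adjoint A *\<^sub>v (A *\<^sub>v v))
      = A *\<^sub>v (mat_adjoint A *\<^sub>v (A *\<^sub>v v)) + A *\<^sub>v (mat_adjoint B *\<^sub>v (B *\<^sub>v v))"
    unfolding zero by (intro eq_vecI) auto
  also have "\<dots> = A *\<^sub>v (mat_adjoint A *\<^sub>v (A *\<^sub>v v) + mat_adjoint B *\<^sub>v (B *\<^sub>v v))"
    by (rule mult_add_distrib_mat_vec[symmetric, OF A]) (auto intro: carrier_vecI)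
  also have "\<dots> = 0\<^sub>v m" unfolding split using A by (rule mat_mult_zero_vec)
  \<comment> \<open>The cancellation is applied to \<open>A\<^sup>*\<close> in place of
    \<open>A\<close>, at the vector \<open>A v\<close>.\<close>
  finally have AsA0: "mat_adjoint A *\<^sub>v (A *\<^sub>v v) = 0\<^sub>v n"
    using mat_adjoint_mult_eq_0D[of "mat_adjoint A" n m "A *\<^sub>v v"] A Av by simp
  have "mat_adjoint B *\<^sub>v (B *\<^sub>v v) = 0\<^sub>v n + mat_adjoint B *\<^sub>v (B *\<^sub>v v)"
    by (rule eq_vecI) auto
  also have "\<dots> = 0\<^sub>v n" using split unfolding AsA0 .
  finally have "B *\<^sub>v v = 0\<^sub>v m" by (rule mat_adjoint_mult_eq_0D[OF B v])
  then show "v = 0\<^sub>v n"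
    using inj[OF v] mat_adjoint_mult_eq_0D[OF A v AsA0] by blast
qed (use that in blast)

text \<open>A vector in the kernel of \<open>A\<close> has the form \<open>B\<^sup>* y\<close>, and
  \<open>B B\<^sup>* y = 0\<close> forces \<open>B\<^sup>* y = 0\<close>.\<close>

lemma kernels_meet_trivially:
  fixes A B :: "'a :: conjugatable_ordered_field mat"
  assumes A: "A \<in> carrier_mat m n" and B: "B \<in> carrier_mat m n"
    and range: "mat_range (mat_adjoint B) = mat_kernel A"
    and v: "v \<in> carrier_vec n" and "A *\<^sub>v v = 0\<^sub>v m" "B *\<^sub>v v = 0\<^sub>v m"
  shows "v = 0\<^sub>v n"
proof -
  have "v \<in> mat_range (mat_adjoint B)" using assms by (auto intro: mat_kernelI)
  then obtain y where y: "y \<in> carrier_vec m" "v = mat_adjoint B *\<^sub>v y"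
    using mat_range_eq[of "mat_adjoint B" n m] B by auto
  then show ?thesis
    using mat_adjoint_mult_eq_0D[of "mat_adjoint B" n m y] B assms by simp
qed

text \<open>Case (i). The second conclusion ensures that the description \<open>mp_inverse A\<close>
  denotes a Moore-Penrose inverse, which the passage to adjoints in case (ii) relies on.\<close>

lemma mp_inverse_left_equation:
  fixes A B :: "'a :: conjugatable_ordered_field mat"
  assumes A: "A \<in> carrier_mat m n" and B: "B \<in> carrier_mat m n"
    and range: "mat_range (mat_adjoint B) = mat_kernel A"
  shows "invertible_mat (mat_adjoint A * A + mat_adjoint B * B)"
    and "is_mp_inverse A (mp_inverse A)"
    and "X \<in> carrier_mat n m \<and> (mat_adjoint A * A + mat_adjoint B * B) * X = mat_adjoint A
      \<longleftrightarrow> X = mp_inverse A"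
proof -
  define M where "M = mat_adjoint A * A + mat_adjoint B * B"
  have M: "M \<in> carrier_mat n n" using A B by (auto simp: M_def)
  have AB: "A * mat_adjoint B = 0\<^sub>m m m"
    using mult_eq_0_if_range_subset_kernel[OF A] B range by simp
  obtain C where C: "C \<in> carrier_mat n n" and MC: "M * C = 1\<^sub>m n" and CM: "C * M = 1\<^sub>m n"
    using gram_sum_inverse_ex[OF A B AB kernels_meet_trivially[OF A B range]]
    unfolding M_def by blast
  have mp: "is_mp_inverse A (C * mat_adjoint A)"
    using mp_inverse_if_orthogonal_rows[OF A B AB C] MC CM by (simp add: M_def)
  then have eq: "mp_inverse A = C * mat_adjoint A" by (rule mp_inverse_eqI)
  show "invertible_mat (mat_adjoint A * A + mat_adjoint B * B)"
    using invertible_matI[OF M C MC CM] by (simp add: M_def)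
  show "is_mp_inverse A (mp_inverse A)" using mp eq by simp
  have "M * (C * mat_adjoint A) = mat_adjoint A"
    using A C M MC by (simp add: mult_mat_left_cong)
  then show "X \<in> carrier_mat n m \<and> (mat_adjoint A * A + mat_adjoint B * B) * X = mat_adjoint A
      \<longleftrightarrow> X = mp_inverse A"
    unfolding eq M_def[symmetric] using A C by (intro left_equation_iff[OF M C CM]) auto
qed

lemma mp_inverse_right_equation:
  fixes A B :: "'a :: conjugatable_ordered_field mat"
  assumes A: "A \<in> carrier_mat m n" and B: "B \<in> carrier_mat m n"
    and range: "mat_range B = mat_kernel (mat_adjoint A)"
  shows "invertible_mat (A * mat_adjoint A + B * mat_adjoint B)"
    and "X \<in> carrier_mat n m \<and> X * (A * mat_adjoint A + B * mat_adjoint B) = mat_adjoint A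
      \<longleftrightarrow> X = mp_inverse A"
proof -
  define M where "M = A * mat_adjoint A + B * mat_adjoint B"
  have M: "M \<in> carrier_mat m m" and M_adj: "mat_adjoint M = M"
    using A B by (auto simp: M_def mat_dim_simps)
  note left = mp_inverse_left_equation[of "mat_adjoint A" n m "mat_adjoint B", unfolded mat_adjoint_adjoint,
      OF mat_adjoint_carrier[OF A] mat_adjoint_carrier[OF B] range, folded M_def]
  show "invertible_mat (A * mat_adjoint A + B * mat_adjoint B)"
    using left(1) by (simp add: M_def)
  have "is_mp_inverse A (mat_adjoint (mp_inverse (mat_adjoint A)))"
    using is_mp_inverse_adjoint[OF left(2)] by simp
  then have eq: "mat_adjoint (mp_inverse A) = mp_inverse (mat_adjoint A)"
    using mp_inverse_eqI by fastforce
  \<comment> \<open>As \<open>M\<close> is Hermitian, taking adjoints turns the right equation for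
    \<open>X\<close> into the left equation for \<open>X\<^sup>*\<close>.\<close>
  have "X \<in> carrier_mat n m \<and> X * M = mat_adjoint A
      \<longleftrightarrow> mat_adjoint X \<in> carrier_mat m n \<and> M * mat_adjoint X = A"
  proof (rule conj_cong)
    show "X \<in> carrier_mat n m \<longleftrightarrow> mat_adjoint X \<in> carrier_mat m n"
      by (metis mat_adjoint_adjoint mat_adjoint_carrier)
    assume "mat_adjoint X \<in> carrier_mat m n"
    then have "mat_adjoint (X * M) = M * mat_adjoint X"
      using M by (subst mat_adjoint_mult) (auto simp: M_adj)
    then show "X * M = mat_adjoint A \<longleftrightarrow> M * mat_adjoint X = A"
      by (metis mat_adjoint_adjoint)
  qed
  also have "\<dots> \<longleftrightarrow> mat_adjoint X = mp_inverse (mat_adjoint A)" by (rule left(3))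
  also have "\<dots> \<longleftrightarrow> X = mp_inverse A" unfolding eq[symmetric] by (metis mat_adjoint_adjoint)
  finally show "X \<in> carrier_mat n m \<and> X * (A * mat_adjoint A + B * mat_adjoint B) = mat_adjoint A
      \<longleftrightarrow> X = mp_inverse A"
    by (simp add: M_def)
qed

section \<open>The sum of two orthogonal matrices: case (iii)\<close>

text \<open>If \<open>A + B\<close> kills \<open>v\<close>, applying \<open>A\<^sup>*\<close>
  removes the \<open>B\<close> term, so \<open>A\<^sup>* A v = 0\<close>. Hence
  \<open>A v = 0\<close>, then \<open>B v = 0\<close>, and the kernels meet only in zero.\<close>

lemma add_inverse_ex:
  fixes A B :: "'a :: conjugatable_ordered_field mat"
  assumes A: "A \<in> carrier_mat n n" and B: "B \<in> carrier_mat n n"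
    and range: "mat_range (mat_adjoint B) = mat_kernel A"
    and AB: "mat_adjoint A * B = 0\<^sub>m n n"
  obtains D where "D \<in> carrier_mat n n" "(A + B) * D = 1\<^sub>m n" "D * (A + B) = 1\<^sub>m n"
proof (rule inverse_mat_ex_if_kernel_trivial)
  show "A + B \<in> carrier_mat n n" using A B by auto
  fix v :: "'a vec"
  assume v: "v \<in> carrier_vec n" and 0: "(A + B) *\<^sub>v v = 0\<^sub>v n"
  note dims [simp] = carrier_matD[OF A] carrier_matD[OF B] carrier_vecD[OF v]
  have Av: "A *\<^sub>v v \<in> carrier_vec n" and Bv: "B *\<^sub>v v \<in> carrier_vec n" using A B v by auto
  have "mat_adjoint A *\<^sub>v (A *\<^sub>v v) = mat_adjoint A * (A + B) *\<^sub>v v"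
    using A B v by (simp add: mult_add_mat_dim AB add_zero_mat_dim mult_mat_vec_assoc_dim)
  also have "\<dots> = mat_adjoint A *\<^sub>v ((A + B) *\<^sub>v v)"
    by (simp add: mult_mat_vec_assoc_dim)
  also have "\<dots> = 0\<^sub>v n" unfolding 0 using A by (simp add: mat_mult_zero_vec[of _ n])
  finally have A0: "A *\<^sub>v v = 0\<^sub>v n" using mat_adjoint_mult_eq_0D[OF A v] by blast
  moreover have "B *\<^sub>v v = 0\<^sub>v n"
    using 0 A0 Bv by (simp add: add_mult_distrib_mat_vec[OF A B v])
  ultimately show "v = 0\<^sub>v n" using kernels_meet_trivially[OF A B range v] by blast
qed (use that in blast)

lemma mp_inverse_add:
  fixes A B :: "'a :: conjugatable_ordered_field mat"
  assumes A: "A \<in> carrier_mat n n" and B: "B \<in> carrier_mat n n"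
    and ABs: "A * mat_adjoint B = 0\<^sub>m n n" and AsB: "mat_adjoint A * B = 0\<^sub>m n n"
    and D: "D \<in> carrier_mat n n" and SD: "(A + B) * D = 1\<^sub>m n" and DS: "D * (A + B) = 1\<^sub>m n"
  shows "mp_inverse A = D - mp_inverse B"
    and "X \<in> carrier_mat n n \<and> (A + B) * X = orth_proj n (mat_kernel (mat_adjoint B))
      \<longleftrightarrow> X = mp_inverse A"
    and "X \<in> carrier_mat n n \<and> X * (A + B) = orth_proj n (mat_kernel B) \<longleftrightarrow> X = mp_inverse A"
proof -
  note dims [simp] = carrier_matD[OF A] carrier_matD[OF B] carrier_matD[OF D]
  have BAs: "B * mat_adjoint A = 0\<^sub>m n n"
    using arg_cong[OF ABs, of mat_adjoint] by (simp add: mat_adjoint_mult)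
  have BsA: "mat_adjoint B * A = 0\<^sub>m n n"
    using arg_cong[OF AsB, of mat_adjoint] by (simp add: mat_adjoint_mult)
  define M where "M = mat_adjoint A * A + mat_adjoint B * B"
  \<comment> \<open>The inverse of \<open>M\<close>, because the cross terms vanish in the Gram
    matrix of \<open>A + B\<close>, which is therefore \<open>M\<close>.\<close>
  define C where "C = D * mat_adjoint D"
  define X where "X = C * mat_adjoint A"
  define Y where "Y = C * mat_adjoint B"
  have S: "A + B \<in> carrier_mat n n" and M: "M \<in> carrier_mat n n" and C: "C \<in> carrier_mat n n"
    and X: "X \<in> carrier_mat n n" and Y: "Y \<in> carrier_mat n n"
    by (auto simp: M_def C_def X_def Y_def intro!: carrier_matI)
  note dims' [simp] = carrier_matD[OF M] carrier_matD[OF C] carrier_matD[OF X] carrier_matD[OF Y]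
  have M_eq: "M = mat_adjoint (A + B) * (A + B)"
    using A B
    by (simp add: M_def mat_dim_simps AsB BsA add_zero_mat_dim)
  have DsSs: "mat_adjoint D * mat_adjoint (A + B) = 1\<^sub>m n"
    using arg_cong[OF SD, of mat_adjoint] by (simp add: mat_adjoint_mult)
  have CSs: "C * mat_adjoint (A + B) = D"
    using D by (simp add: C_def mult_mat_assoc_dim DsSs)
  have CM: "C * M = 1\<^sub>m n"
  proof -
    have "C * M = C * mat_adjoint (A + B) * (A + B)" unfolding M_eq by (simp add: mult_mat_assoc_dim)
    then show ?thesis by (simp only: CSs DS)
  qed
  have MC: "M * C = 1\<^sub>m n" by (rule mat_mult_left_right_inverse[OF C M CM])
  have mpX: "is_mp_inverse A X"
    using mp_inverse_if_orthogonal_rows[OF A B ABs C] MC CM by (simp add: M_def X_def)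
  have M_comm: "mat_adjoint B * B + mat_adjoint A * A = M"
    unfolding M_def by (rule comm_add_mat[of _ n n]) (auto intro: carrier_matI)
  have mpY: "is_mp_inverse B Y"
    using mp_inverse_if_orthogonal_rows[OF B A BAs C] MC CM by (simp add: M_comm Y_def)
  have eqX: "mp_inverse A = X" and eqY: "mp_inverse B = Y"
    using mpX mpY by (simp_all add: mp_inverse_eqI)
  have XY: "X + Y = D"
    unfolding CSs[symmetric] X_def Y_def by (simp add: mat_dim_simps)
  have "X = D - Y" unfolding XY[symmetric] using X Y by (intro eq_matI) auto
  then show "mp_inverse A = D - mp_inverse B" by (simp add: eqX eqY)

  text \<open>\<open>X = X X\<^sup>* A\<^sup>* = A\<^sup>* X\<^sup>* X\<close>, and likewise for \<open>Y\<close> and \<open>B\<close>.\<close>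
  have XAX: "X * (A * X) = X" and AXh: "mat_adjoint X * mat_adjoint A = A * X"
    and XAh: "mat_adjoint A * mat_adjoint X = X * A"
    using mpX by (auto simp: is_mp_inverse_def mat_adjoint_mult mult_mat_assoc_dim)
  have YBY: "Y * (B * Y) = Y" and BYh: "mat_adjoint Y * mat_adjoint B = B * Y"
    and YBh: "mat_adjoint B * mat_adjoint Y = Y * B"
    using mpY by (auto simp: is_mp_inverse_def mat_adjoint_mult mult_mat_assoc_dim)
  have X1: "X = mat_adjoint A * (mat_adjoint X * X)" and X2: "X = X * (mat_adjoint X * mat_adjoint A)"
    using XAX AXh mult_mat_left_cong[OF XAh, of X] by (simp_all add: mult_mat_assoc_dim)
  have Y1: "Y = mat_adjoint B * (mat_adjoint Y * Y)" and Y2: "Y = Y * (mat_adjoint Y * mat_adjoint B)"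
    using YBY BYh mult_mat_left_cong[OF YBh, of Y] by (simp_all add: mult_mat_assoc_dim)
  \<comment> \<open>\<open>X\<close> factors through \<open>A\<^sup>*\<close> on both sides and
    \<open>Y\<close> through \<open>B\<^sup>*\<close>, so the orthogonality relations kill all four
    mixed products.\<close>
  have BX: "B * X = 0\<^sub>m n n"
    by (subst X1) (simp add: mult_mat_cancel_0[OF BAs])
  have AY: "A * Y = 0\<^sub>m n n"
    by (subst Y1) (simp add: mult_mat_cancel_0[OF ABs])
  have XB: "X * B = 0\<^sub>m n n"
    by (subst X2) (simp add: mult_mat_assoc_dim AsB)
  have YA: "Y * A = 0\<^sub>m n n"
    by (subst Y2) (simp add: mult_mat_assoc_dim BsA)
  have SX: "(A + B) * X = A * X" and XS: "X * (A + B) = X * A"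
    using A X by (simp_all add: mat_dim_simps BX XB add_zero_mat_dim)
  \<comment> \<open>The product of \<open>A + B\<close> with \<open>D = X + Y\<close>, expanded
    without its vanishing mixed terms.\<close>
  have one1: "A * X + B * Y = 1\<^sub>m n"
    using SD A B X Y
    by (simp add: mat_dim_simps BX AY add_zero_mat_dim
        flip: XY)
  \<comment> \<open>\<open>Y B\<close> is written as \<open>B\<^sup>* Y\<^sup>*\<close> to match the
    shape \<open>P + K\<^sup>* Z = 1\<close> with \<open>K = B\<close>.\<close>
  have one2: "X * A + mat_adjoint B * mat_adjoint Y = 1\<^sub>m n"
    using DS A B X Y
    by (simp add: YBh mat_dim_simps XB YA add_zero_mat_dim
        flip: XY)
  have "orth_proj n (mat_kernel (mat_adjoint B)) = A * X"
    using A B X Y one1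
    by (intro orth_proj_kernel_eqI[of _ n _ _ Y]) (auto simp: mult_mat_cancel_0[OF BsA])
  then show "Z \<in> carrier_mat n n \<and> (A + B) * Z = orth_proj n (mat_kernel (mat_adjoint B))
      \<longleftrightarrow> Z = mp_inverse A" for Z
    unfolding eqX using SX by (intro left_equation_iff[OF S D DS X]) simp
  have "orth_proj n (mat_kernel B) = X * A"
    using A B X Y one2
    by (intro orth_proj_kernel_eqI[of _ n _ _ "mat_adjoint Y"]) (auto simp: mult_mat_cancel_0[OF BX])
  then show "Z \<in> carrier_mat n n \<and> Z * (A + B) = orth_proj n (mat_kernel B)
      \<longleftrightarrow> Z = mp_inverse A" for Z
    unfolding eqX using XS by (intro right_equation_iff[OF S D SD X]) simp
qed

text \<open>Either alternative contains both inclusions, hence both orthogonality relations. The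
  equality serves only to make \<open>A + B\<close> invertible, directly or through its
  adjoint.\<close>

lemma mp_inverse_add_range:
  fixes A B :: "'a :: conjugatable_ordered_field mat"
  assumes A: "A \<in> carrier_mat n n" and B: "B \<in> carrier_mat n n"
    and range:
      "mat_range (mat_adjoint B) = mat_kernel A \<and> mat_range B \<subseteq> mat_kernel (mat_adjoint A) \<or>
       mat_range (mat_adjoint B) \<subseteq> mat_kernel A \<and> mat_range B = mat_kernel (mat_adjoint A)"
  shows "invertible_mat (A + B)"
    and "mp_inverse A = the (mat_inverse (A + B)) - mp_inverse B"
    and "X \<in> carrier_mat n n \<and> (A + B) * X = orth_proj n (mat_kernel (mat_adjoint B))
      \<longleftrightarrow> X = mp_inverse A"
    and "X \<in> carrier_mat n n \<and> X * (A + B) = orth_proj n (mat_kernel B) \<longleftrightarrow> X = mp_inverse A"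
proof -
  have S: "A + B \<in> carrier_mat n n" using A B by auto
  have ABs: "A * mat_adjoint B = 0\<^sub>m n n" and AsB: "mat_adjoint A * B = 0\<^sub>m n n"
    using mult_eq_0_if_range_subset_kernel[OF A mat_adjoint_carrier[OF B]]
      mult_eq_0_if_range_subset_kernel[OF mat_adjoint_carrier[OF A] B] range by auto
  obtain D where D: "D \<in> carrier_mat n n" and SD: "(A + B) * D = 1\<^sub>m n" and DS: "D * (A + B) = 1\<^sub>m n"
  proof (cases "mat_range (mat_adjoint B) = mat_kernel A")
    case True
    from add_inverse_ex[OF A B True AsB] that show thesis by blast
  next
    case False
    then have "mat_range B = mat_kernel (mat_adjoint A)" using range by blast
    \<comment> \<open>For the adjoint pair the second alternative has the shape of the first; the
      adjoint of the resulting \<open>E\<close> inverts \<open>A + B\<close>.\<close>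
    with add_inverse_ex[of "mat_adjoint A" n "mat_adjoint B"] A B ABs
    obtain E where E: "E \<in> carrier_mat n n" and "(mat_adjoint A + mat_adjoint B) * E = 1\<^sub>m n"
        and "E * (mat_adjoint A + mat_adjoint B) = 1\<^sub>m n"
      by auto
    then have "mat_adjoint (mat_adjoint (A + B) * E) = 1\<^sub>m n"
        and "mat_adjoint (E * mat_adjoint (A + B)) = 1\<^sub>m n"
      using A B by (simp_all add: mat_adjoint_add)
    then have "mat_adjoint E * (A + B) = 1\<^sub>m n" and "(A + B) * mat_adjoint E = 1\<^sub>m n"
      using A B E by (simp_all add: mat_adjoint_mult)
    with E that show thesis by (meson mat_adjoint_carrier)
  qed
  show "invertible_mat (A + B)" by (rule invertible_matI[OF S D SD DS])
  show "mp_inverse A = the (mat_inverse (A + B)) - mp_inverse B"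
    unfolding the_mat_inverse_eq[OF S D SD DS] by (rule mp_inverse_add(1)[OF A B ABs AsB D SD DS])
  show "X \<in> carrier_mat n n \<and> (A + B) * X = orth_proj n (mat_kernel (mat_adjoint B))
      \<longleftrightarrow> X = mp_inverse A"
    by (rule mp_inverse_add(2)[OF A B ABs AsB D SD DS])
  show "X \<in> carrier_mat n n \<and> X * (A + B) = orth_proj n (mat_kernel B) \<longleftrightarrow> X = mp_inverse A"
    by (rule mp_inverse_add(3)[OF A B ABs AsB D SD DS])
qed

text \<open>Real and complex numbers are both instances of
  \<open>conjugatable_ordered_field\<close>, so the general lemmas settle both halves.\<close>

theorem theorem3p4:
  fixes m n :: nat
  shows
    "(\<forall>A B :: real mat. A \<in> carrier_mat m n \<longrightarrow> B \<in> carrier_mat m n \<longrightarrow>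
        (mat_range (mat_adjoint B) = mat_kernel A \<longrightarrow>
           invertible_mat (mat_adjoint A * A + mat_adjoint B * B) \<and>
           (\<forall>X. X \<in> carrier_mat n m \<and> (mat_adjoint A * A + mat_adjoint B * B) * X = mat_adjoint A
                \<longleftrightarrow> X = mp_inverse A)) \<and>
        (mat_range B = mat_kernel (mat_adjoint A) \<longrightarrow>
           invertible_mat (A * mat_adjoint A + B * mat_adjoint B) \<and>
           (\<forall>X. X \<in> carrier_mat n m \<and> X * (A * mat_adjoint A + B * mat_adjoint B) = mat_adjoint A
                \<longleftrightarrow> X = mp_inverse A)) \<and>
        (m = n \<and>
         (mat_range (mat_adjoint B) = mat_kernel A \<and> mat_range B \<subseteq> mat_kernel (mat_adjoint A) \<or>
          mat_range (mat_adjoint B) \<subseteq> mat_kernel A \<and> mat_range B = mat_kernel (mat_adjoint A)) \<longrightarrow>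
           invertible_mat (A + B) \<and>
           mp_inverse A = the (mat_inverse (A + B)) - mp_inverse B \<and>
           (\<forall>X. X \<in> carrier_mat n n \<and> (A + B) * X = orth_proj n (mat_kernel (mat_adjoint B))
                \<longleftrightarrow> X = mp_inverse A) \<and>
           (\<forall>X. X \<in> carrier_mat n n \<and> X * (A + B) = orth_proj n (mat_kernel B)
                \<longleftrightarrow> X = mp_inverse A))) \<and>
     (\<forall>A B :: complex mat. A \<in> carrier_mat m n \<longrightarrow> B \<in> carrier_mat m n \<longrightarrow>
        (mat_range (mat_adjoint B) = mat_kernel A \<longrightarrow>
           invertible_mat (mat_adjoint A * A + mat_adjoint B * B) \<and>
           (\<forall>X. X \<in> carrier_mat n m \<and> (mat_adjoint A * A + mat_adjoint B * B) * X = mat_adjoint A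
                \<longleftrightarrow> X = mp_inverse A)) \<and>
        (mat_range B = mat_kernel (mat_adjoint A) \<longrightarrow>
           invertible_mat (A * mat_adjoint A + B * mat_adjoint B) \<and>
           (\<forall>X. X \<in> carrier_mat n m \<and> X * (A * mat_adjoint A + B * mat_adjoint B) = mat_adjoint A
                \<longleftrightarrow> X = mp_inverse A)) \<and>
        (m = n \<and>
         (mat_range (mat_adjoint B) = mat_kernel A \<and> mat_range B \<subseteq> mat_kernel (mat_adjoint A) \<or>
          mat_range (mat_adjoint B) \<subseteq> mat_kernel A \<and> mat_range B = mat_kernel (mat_adjoint A)) \<longrightarrow>
           invertible_mat (A + B) \<and>
           mp_inverse A = the (mat_inverse (A + B)) - mp_inverse B \<and>
           (\<forall>X. X \<in> carrier_mat n n \<and> (A + B) * X = orth_proj n (mat_kernel (mat_adjoint B))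
                \<longleftrightarrow> X = mp_inverse A) \<and>
           (\<forall>X. X \<in> carrier_mat n n \<and> X * (A + B) = orth_proj n (mat_kernel B)
                \<longleftrightarrow> X = mp_inverse A)))"
  \<comment> \<open>For case (iii), \<open>conjE\<close> isolates \<open>m = n\<close> for
    \<open>hypsubst\<close> and leaves the disjunction of range conditions whole.\<close>
  by (intro conjI allI impI; (elim conjE)?;
      (rule mp_inverse_left_equation mp_inverse_right_equation; assumption)?;
      (hypsubst, rule mp_inverse_add_range; assumption)?)

end
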